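(* Let $A\in\mathbb{R}^{m\times n}$ be semimonotone ($A^{\dagger}\geq 0$) and let $(U_k,V_k,E_k)_{k=1}^{p}$ be a proper weak regular multisplitting of $A$ with $R(E_k)\subseteq R(A^{T})$ for each $k=1,\ldots,p$. Let $H=\sum_{k=1}^{p}E_kU_k^{\dagger}V_k$. Let $\underline{U},\overline{U}\in\mathbb{R}^{m\times n}$ be such that $\overline{U}^{\dagger}\leq U_k^{\dagger}\leq\underline{U}^{\dagger}$ for each $k=1,\ldots,p$. (i) If $A=\overline{U}-\overline{V}$ is a proper regular splitting and the row sums of $\overline{U}^{\dagger}$ are positive, then $\rho(H)\leq\rho(\overline{U}^{\dagger}\overline{V})$. (ii) If $A=\underline{U}-\underline{V}$ is a proper regular splitting, then $\rho(\underline{U}^{\dagger}\underline{V})\leq\rho(H)$.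
   Context: $A^{\dagger}$ denotes the Moore–Penrose inverse, $\rho(\cdot)$ the spectral radius, $R(\cdot)$, $N(\cdot)$ range and null space; inequalities are entrywise. A splitting $A=U-V$ is proper if $R(U)=R(A)$ and $N(U)=N(A)$; a proper splitting is proper weak regular if $U^{\dagger}\geq 0$ and $U^{\dagger}V\geq 0$, and proper regular if $U^{\dagger}\geq 0$ and $V\geq 0$. A proper weak regular multisplitting of $A$ is a triplet $(U_k,V_k,E_k)_{k=1}^{p}$ where each $A=U_k-V_k$ is a proper weak regular splitting and each $E_k\geq 0$ is an $n\times n$ diagonal matrix with $\sum_{k=1}^{p}E_k=I_n$. *)

theory Defs
  imports "Jordan_Normal_Form.Spectral_Radius" "Jordan_Normal_Form.Matrix_Kernel"
begin

definition nonneg_mat :: "real mat \<Rightarrow> bool" where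
  "nonneg_mat A \<longleftrightarrow> (\<forall>i < dim_row A. \<forall>j < dim_col A. A $$ (i,j) \<ge> 0)"

definition mat_le :: "real mat \<Rightarrow> real mat \<Rightarrow> bool" where
  "mat_le A B \<longleftrightarrow> dim_row A = dim_row B \<and> dim_col A = dim_col B \<and>
     (\<forall>i < dim_row A. \<forall>j < dim_col A. A $$ (i,j) \<le> B $$ (i,j))"

definition pinv :: "real mat \<Rightarrow> real mat" where
  "pinv A = (THE X. X \<in> carrier_mat (dim_col A) (dim_row A) \<and>
       A * X * A = A \<and> X * A * X = X \<and>
       transpose_mat (A * X) = A * X \<and> transpose_mat (X * A) = X * A)"

definition mat_range :: "real mat \<Rightarrow> real vec set" where
  "mat_range A = {A *\<^sub>v x | x. x \<in> carrier_vec (dim_col A)}"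

definition rho :: "real mat \<Rightarrow> real" where
  "rho M = spectral_radius (map_mat complex_of_real M)"

definition proper_splitting :: "real mat \<Rightarrow> real mat \<Rightarrow> real mat \<Rightarrow> bool" where
  "proper_splitting A U V \<longleftrightarrow>
     U \<in> carrier_mat (dim_row A) (dim_col A) \<and> V \<in> carrier_mat (dim_row A) (dim_col A) \<and>
     A = U - V \<and> mat_range U = mat_range A \<and> mat_kernel U = mat_kernel A"

definition proper_weak_regular_splitting :: "real mat \<Rightarrow> real mat \<Rightarrow> real mat \<Rightarrow> bool" where
  "proper_weak_regular_splitting A U V \<longleftrightarrow>
     proper_splitting A U V \<and> nonneg_mat (pinv U) \<and> nonneg_mat (pinv U * V)"

definition proper_regular_splitting :: "real mat \<Rightarrow> real mat \<Rightarrow> real mat \<Rightarrow> bool" where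
  "proper_regular_splitting A U V \<longleftrightarrow>
     proper_splitting A U V \<and> nonneg_mat (pinv U) \<and> nonneg_mat V"

definition proper_weak_regular_multisplitting ::
  "real mat \<Rightarrow> nat \<Rightarrow> (nat \<Rightarrow> real mat) \<Rightarrow> (nat \<Rightarrow> real mat) \<Rightarrow> (nat \<Rightarrow> real mat) \<Rightarrow> bool" where
  "proper_weak_regular_multisplitting A p U V E \<longleftrightarrow>
     (\<forall>k < p. proper_weak_regular_splitting A (U k) (V k) \<and>
        E k \<in> carrier_mat (dim_col A) (dim_col A) \<and> diagonal_mat (E k) \<and> nonneg_mat (E k)) \<and>
     (\<forall>i < dim_col A. \<forall>j < dim_col A. (\<Sum>k<p. E k $$ (i,j)) = (1\<^sub>m (dim_col A)) $$ (i,j))"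

definition multisplit_H :: "nat \<Rightarrow> nat \<Rightarrow> (nat \<Rightarrow> real mat) \<Rightarrow> (nat \<Rightarrow> real mat) \<Rightarrow> (nat \<Rightarrow> real mat) \<Rightarrow> real mat" where
  "multisplit_H n p U V E = mat n n (\<lambda>(i,j). \<Sum>k<p. (E k * pinv (U k) * V k) $$ (i,j))"

end

theory Submission
  imports Defs
begin

text \<open>
  The identity matrix is the sum of the \<open>E k\<close>, so the range condition forces the transpose of
  \<open>A\<close> to be onto: \<open>A\<close> has full column rank and its pseudoinverse \<open>C\<close> is a left inverse. For a
  proper splitting \<open>A = U - V\<close> with \<open>P = pinv U\<close> this gives \<open>P V C = C - P = C V P\<close>, and summing
  the first identity with weights \<open>E k\<close> shows that the bounds on the pseudoinverses order
  \<open>H C\<close> against \<open>P V C\<close>. No Perron vectors are required: the entrywise modulus \<open>x\<close> of an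
  eigenvector of maximal modulus satisfies \<open>rho M x \<le> M x\<close>, and conversely \<open>l x \<le> M x\<close> with
  \<open>x \<ge> 0\<close> nonzero forces \<open>l \<le> rho M\<close>, since otherwise the powers of a rescaled \<open>M\<close> would be
  both bounded and growing. Such an \<open>x\<close> is carried over to \<open>C V x\<close> for the lower bound, and a
  left vector \<open>z\<close> of \<open>H\<close> to \<open>z C V\<close> for the upper bound.
\<close>

section \<open>Entrywise order on vectors and matrices\<close>

lemma index_mult_mat_vec_sum:
  assumes "M \<in> carrier_mat n k" "x \<in> carrier_vec k" "i < n"
  shows "(M *\<^sub>v x) $ i = (\<Sum>j<k. M $$ (i,j) * x $ j)"
  using assms by (simp add: scalar_prod_def lessThan_atLeast0)

lemma mult_mat_vec_mono:
  fixes x y :: "real vec"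
  assumes M: "M \<in> carrier_mat n k" and M0: "nonneg_mat M"
    and y: "y \<in> carrier_vec k" and le: "x \<le> y"
  shows "M *\<^sub>v x \<le> M *\<^sub>v y"
  using assms
  by (auto simp: less_eq_vec_def nonneg_mat_def scalar_prod_def intro!: sum_mono mult_left_mono)

lemma mat_le_mult_mat_vec:
  fixes x :: "real vec"
  assumes M: "M \<in> carrier_mat n k" and N: "N \<in> carrier_mat n k" and MN: "mat_le M N"
    and x: "x \<in> carrier_vec k" and x0: "0\<^sub>v k \<le> x"
  shows "M *\<^sub>v x \<le> N *\<^sub>v x"
  using assms
  by (auto simp: less_eq_vec_def mat_le_def scalar_prod_def intro!: sum_mono mult_right_mono)

lemma mult_mat_zero_vec:
  fixes M :: "'a :: semiring_0 mat"
  assumes "M \<in> carrier_mat n k"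
  shows "M *\<^sub>v 0\<^sub>v k = 0\<^sub>v n"
  using assms by (intro eq_vecI) auto

lemma nonneg_mult_mat_vec:
  fixes x :: "real vec"
  assumes M: "M \<in> carrier_mat n k" and M0: "nonneg_mat M"
    and x: "x \<in> carrier_vec k" and x0: "0\<^sub>v k \<le> x"
  shows "0\<^sub>v n \<le> M *\<^sub>v x"
  using mult_mat_vec_mono[OF M M0 x x0] mult_mat_zero_vec[OF M] by simp

lemma smult_vec_nonneg_mono:
  fixes x y :: "real vec"
  assumes "x \<le> y" "0 \<le> c"
  shows "c \<cdot>\<^sub>v x \<le> c \<cdot>\<^sub>v y"
  using assms by (auto simp: less_eq_vec_def intro: mult_left_mono)

lemma nonneg_mat_mult:
  assumes "M \<in> carrier_mat n k" "N \<in> carrier_mat k l" "nonneg_mat M" "nonneg_mat N"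
  shows "nonneg_mat (M * N)"
  using assms by (auto simp: nonneg_mat_def scalar_prod_def intro!: sum_nonneg)

lemma nonneg_mat_transpose: "nonneg_mat M \<Longrightarrow> nonneg_mat (transpose_mat M)"
  by (auto simp: nonneg_mat_def)

lemma mat_le_transpose: "mat_le M N \<Longrightarrow> mat_le (transpose_mat M) (transpose_mat N)"
  by (auto simp: mat_le_def)

lemma nonneg_vec_pos_entry:
  fixes x :: "real vec"
  assumes x: "x \<in> carrier_vec n" and x0: "0\<^sub>v n \<le> x" and xn: "x \<noteq> 0\<^sub>v n"
  obtains i where "i < n" "x $ i > 0"
proof -
  have "\<exists>i<n. x $ i \<noteq> 0"
    using x xn by (metis carrier_vecD eq_vecI index_zero_vec)
  thus ?thesis using that x x0 by (auto simp: less_eq_vec_def order_less_le)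
qed

section \<open>Spectral radius of nonnegative matrices\<close>

lemma spectrum_transpose_mat:
  fixes M :: "'a :: field mat"
  assumes "M \<in> carrier_mat n n"
  shows "spectrum (transpose_mat M) = spectrum M"
  using assms by (simp add: spectrum_root_char_poly[of _ n])

lemma rho_transpose:
  assumes "M \<in> carrier_mat n n"
  shows "rho (transpose_mat M) = rho M"
proof -
  have "map_mat complex_of_real (transpose_mat M) = transpose_mat (map_mat complex_of_real M)"
    by auto
  thus ?thesis
    using assms by (simp add: rho_def spectral_radius_def spectrum_transpose_mat[of _ n])
qed

text \<open>Positive dimension makes the complex spectrum nonempty, so the maximum that defines the
  spectral radius is attained.\<close>

lemma rho_eigenvector:
  assumes M: "M \<in> carrier_mat n n" and n: "n > 0"
  obtains v c where "v \<in> carrier_vec n" "v \<noteq> 0\<^sub>v n"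
    "map_mat complex_of_real M *\<^sub>v v = c \<cdot>\<^sub>v v" "norm c = rho M"
proof -
  let ?M = "map_mat complex_of_real M"
  have M': "?M \<in> carrier_mat n n" using M by simp
  from spectral_radius_mem_max(1)[OF M' n] obtain c
    where c: "eigenvalue ?M c" "norm c = rho M"
    unfolding spectrum_def rho_def by auto
  then obtain v where "eigenvector ?M v c" unfolding eigenvalue_def by blast
  thus ?thesis using that c(2) M unfolding eigenvector_def by auto
qed

lemma rho_nonneg:
  assumes M: "M \<in> carrier_mat n n" and n: "n > 0"
  shows "rho M \<ge> 0"
  by (rule rho_eigenvector[OF M n]) (metis norm_ge_zero)

text \<open>The triangle inequality in each row of \<open>M v = c v\<close> yields an inequality
  between moduli, because the entries of \<open>M\<close> equal their own absolute values.\<close>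

lemma rho_subeigenvector:
  assumes M: "M \<in> carrier_mat n n" and n: "n > 0" and M0: "nonneg_mat M"
  obtains x where "x \<in> carrier_vec n" "x \<noteq> 0\<^sub>v n" "0\<^sub>v n \<le> x" "rho M \<cdot>\<^sub>v x \<le> M *\<^sub>v x"
proof -
  obtain v c where v: "v \<in> carrier_vec n" "v \<noteq> 0\<^sub>v n"
    and ev: "map_mat complex_of_real M *\<^sub>v v = c \<cdot>\<^sub>v v" and c: "norm c = rho M"
    by (rule rho_eigenvector[OF M n])
  define x where "x = map_vec norm v"
  have x: "x \<in> carrier_vec n" using v x_def by simp
  have "x \<noteq> 0\<^sub>v n"
  proof
    assume 0: "x = 0\<^sub>v n"
    have "v $ i = 0" if "i < n" for i
      using arg_cong[OF 0, of "\<lambda>x. x $ i"] that v by (simp add: x_def)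
    hence "v = 0\<^sub>v n" using v by (intro eq_vecI) auto
    with v show False by simp
  qed
  moreover have "0\<^sub>v n \<le> x" using v by (auto simp: x_def less_eq_vec_def)
  moreover have "rho M \<cdot>\<^sub>v x \<le> M *\<^sub>v x"
    unfolding less_eq_vec_def
  proof (intro conjI allI impI)
    show "dim_vec (rho M \<cdot>\<^sub>v x) = dim_vec (M *\<^sub>v x)" using x M by simp
    fix i assume "i < dim_vec (M *\<^sub>v x)"
    hence i: "i < n" using M by simp
    have "c * v $ i = (\<Sum>j<n. complex_of_real (M $$ (i,j)) * v $ j)"
      using arg_cong[OF ev, of "\<lambda>w. w $ i"] i M v by (simp add: scalar_prod_def lessThan_atLeast0)
    hence "rho M * norm (v $ i) = norm (\<Sum>j<n. complex_of_real (M $$ (i,j)) * v $ j)"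
      by (metis c norm_mult)
    also have "\<dots> \<le> (\<Sum>j<n. norm (complex_of_real (M $$ (i,j)) * v $ j))"
      by (rule norm_sum)
    also have "\<dots> = (\<Sum>j<n. M $$ (i,j) * norm (v $ j))"
      using M0 M i by (intro sum.cong) (auto simp: norm_mult nonneg_mat_def)
    finally show "(rho M \<cdot>\<^sub>v x) $ i \<le> (M *\<^sub>v x) $ i"
      using i M v by (simp add: x_def scalar_prod_def lessThan_atLeast0)
  qed
  ultimately show ?thesis using that x by blast
qed

text \<open>Over the complex numbers this follows from the Jordan normal form; the embedding of the
  reals commutes with powers and keeps absolute values of entries.\<close>

lemma powers_bounded:
  assumes M: "M \<in> carrier_mat n n" and n: "n > 0" and r: "rho M < 1"
  obtains c where "\<And>k i j. i < n \<Longrightarrow> j < n \<Longrightarrow> \<bar>(M ^\<^sub>m k) $$ (i,j)\<bar> \<le> c"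
proof -
  have M': "map_mat complex_of_real M \<in> carrier_mat n n" using M by simp
  obtain c where c: "\<And>k. norm_bound (map_mat complex_of_real M ^\<^sub>m k) c"
    using spectral_radius_jnf_norm_bound_less_1_upper_triangular[OF M'] r unfolding rho_def by blast
  have "\<bar>(M ^\<^sub>m k) $$ (i,j)\<bar> \<le> c" if "i < n" "j < n" for k i j
    using c[of k] that M
    unfolding of_real_hom.mat_hom_pow[OF M, symmetric] norm_bound_def
    by (auto simp: pow_mat_dim_square[of M n])
  thus ?thesis using that by blast
qed

text \<open>An eigenvector of \<open>c M\<close> for \<open>d\<close> is an eigenvector of
  \<open>M\<close> for \<open>d / c\<close>, so \<open>norm d\<close> is at most
  \<open>c * rho M\<close>.\<close>

lemma rho_smult_less_1:
  assumes M: "M \<in> carrier_mat n n" and n: "n > 0" and c: "c > 0" "c * rho M < 1"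
  shows "rho (c \<cdot>\<^sub>m M) < 1"
proof -
  have cM: "c \<cdot>\<^sub>m M \<in> carrier_mat n n" using M by simp
  obtain v d where v: "v \<in> carrier_vec n" "v \<noteq> 0\<^sub>v n"
    and ev: "map_mat complex_of_real (c \<cdot>\<^sub>m M) *\<^sub>v v = d \<cdot>\<^sub>v v" and d: "norm d = rho (c \<cdot>\<^sub>m M)"
    by (rule rho_eigenvector[OF cM n])
  let ?M = "map_mat complex_of_real M"
  have M': "?M \<in> carrier_mat n n" using M by simp
  have "?M *\<^sub>v v = (d / of_real c) \<cdot>\<^sub>v v"
  proof (rule eq_vecI)
    fix i assume "i < dim_vec ((d / of_real c) \<cdot>\<^sub>v v)"
    hence i: "i < n" using v by simp
    have "d * v $ i = (\<Sum>j<n. of_real (c * M $$ (i,j)) * v $ j)"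
      using arg_cong[OF ev, of "\<lambda>w. w $ i"] i M v by (simp add: scalar_prod_def lessThan_atLeast0)
    also have "\<dots> = of_real c * (?M *\<^sub>v v) $ i"
      using i M v by (simp add: scalar_prod_def lessThan_atLeast0 sum_distrib_left mult.assoc)
    finally show "(?M *\<^sub>v v) $ i = ((d / of_real c) \<cdot>\<^sub>v v) $ i"
      using i v c by (simp add: field_simps)
  qed (use M v in simp)
  hence "eigenvector ?M v (d / of_real c)" using v M unfolding eigenvector_def by simp
  hence "norm (d / of_real c) \<in> norm ` spectrum ?M" unfolding spectrum_def eigenvalue_def by blast
  hence "norm (d / of_real c) \<le> rho M"
    unfolding rho_def by (rule spectral_radius_mem_max(2)[OF M' n])
  thus ?thesis using c d by (simp add: norm_divide field_simps)
qed

lemma pow_mat_nonneg: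
  assumes "M \<in> carrier_mat n n" "nonneg_mat M"
  shows "nonneg_mat (M ^\<^sub>m k)"
proof (induction k)
  case 0
  show ?case using assms by (simp add: nonneg_mat_def one_mat_def)
next
  case (Suc k)
  have "M ^\<^sub>m k \<in> carrier_mat n n" using assms by (simp add: pow_carrier_mat)
  thus ?case using nonneg_mat_mult[of _ n n M n] Suc assms by simp
qed

lemma rho_ge_of_subinvariant:
  assumes M: "M \<in> carrier_mat n n" and M0: "nonneg_mat M"
    and x: "x \<in> carrier_vec n" "x \<noteq> 0\<^sub>v n" "0\<^sub>v n \<le> x" and le: "l \<cdot>\<^sub>v x \<le> M *\<^sub>v x"
  shows "l \<le> rho M"
proof (rule ccontr)
  assume "\<not> l \<le> rho M"
  \<comment> \<open>Division by a value strictly between \<open>rho M\<close> and \<open>l\<close>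
    pushes the spectral radius below 1 and still leaves the growth factor
    \<open>t = l / \<mu>\<close> above 1.\<close>
  then obtain \<mu> where mu: "rho M < \<mu>" "\<mu> < l" using dense by (meson not_le)
  obtain i where i: "i < n" "x $ i > 0" by (rule nonneg_vec_pos_entry[OF x(1,3,2)])
  hence n: "n > 0" by simp
  have mu0: "\<mu> > 0" using rho_nonneg[OF M n] mu by linarith
  define B where "B = (1 / \<mu>) \<cdot>\<^sub>m M"
  define t where "t = l / \<mu>"
  have t: "t > 1" using mu mu0 by (simp add: t_def)
  have B: "B \<in> carrier_mat n n" using M by (simp add: B_def)
  have B0: "nonneg_mat B" using M0 mu0 by (simp add: B_def nonneg_mat_def)
  have Bx: "t \<cdot>\<^sub>v x \<le> B *\<^sub>v x"
  proof -
    have "B *\<^sub>v x = (1 / \<mu>) \<cdot>\<^sub>v (M *\<^sub>v x)"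
      using M x by (intro eq_vecI) (auto simp: B_def)
    moreover have "t \<cdot>\<^sub>v x = (1 / \<mu>) \<cdot>\<^sub>v (l \<cdot>\<^sub>v x)" by (simp add: t_def smult_smult_assoc)
    ultimately show ?thesis using smult_vec_nonneg_mono[OF le, of "1 / \<mu>"] mu0 by simp
  qed
  have pow: "B ^\<^sub>m k \<in> carrier_mat n n" for k using B by (simp add: pow_carrier_mat)
  have grow: "t ^ k \<cdot>\<^sub>v x \<le> (B ^\<^sub>m k) *\<^sub>v x" for k
  proof (induction k)
    case 0
    show ?case using B x by simp
  next
    case (Suc k)
    have "t ^ Suc k \<cdot>\<^sub>v x = t \<cdot>\<^sub>v (t ^ k \<cdot>\<^sub>v x)" by (simp add: smult_smult_assoc)
    also have "\<dots> \<le> t \<cdot>\<^sub>v ((B ^\<^sub>m k) *\<^sub>v x)" using smult_vec_nonneg_mono Suc t by simp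
    also have "\<dots> = (B ^\<^sub>m k) *\<^sub>v (t \<cdot>\<^sub>v x)" using pow[of k] x by (simp add: mult_mat_vec)
    also have "\<dots> \<le> (B ^\<^sub>m k) *\<^sub>v (B *\<^sub>v x)"
      using mult_mat_vec_mono[OF pow pow_mat_nonneg[OF B B0] _ Bx] B x by simp
    also have "\<dots> = (B ^\<^sub>m Suc k) *\<^sub>v x" using assoc_mult_mat_vec[OF pow B x(1)] by simp
    finally show ?case .
  qed
  have "rho B < 1" unfolding B_def
    using rho_smult_less_1[OF M n, of "1 / \<mu>"] mu mu0 by simp
  then obtain c where c: "\<And>k i j. i < n \<Longrightarrow> j < n \<Longrightarrow> \<bar>(B ^\<^sub>m k) $$ (i,j)\<bar> \<le> c"
    using powers_bounded[OF B n] by metis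
  \<comment> \<open>In a row where \<open>x\<close> is positive the left side grows geometrically in
    \<open>k\<close>, while the right side does not depend on \<open>k\<close>.\<close>
  have bound: "t ^ k * x $ i \<le> c * (\<Sum>j<n. x $ j)" for k
  proof -
    have "t ^ k * x $ i \<le> ((B ^\<^sub>m k) *\<^sub>v x) $ i"
      using grow[of k] i x pow[of k] by (auto simp: less_eq_vec_def)
    also have "\<dots> = (\<Sum>j<n. (B ^\<^sub>m k) $$ (i,j) * x $ j)"
      by (rule index_mult_mat_vec_sum[OF pow x(1) i(1)])
    also have "\<dots> \<le> (\<Sum>j<n. c * x $ j)"
    proof (intro sum_mono mult_right_mono)
      fix j assume "j \<in> {..<n}"
      thus "(B ^\<^sub>m k) $$ (i,j) \<le> c" "0 \<le> x $ j"
        using c[of i j k] i x by (auto simp: less_eq_vec_def)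
    qed
    finally show ?thesis by (simp add: sum_distrib_left)
  qed
  obtain k where "c * (\<Sum>j<n. x $ j) / x $ i < t ^ k" using real_arch_pow[OF t] by blast
  with bound[of k] i show False by (simp add: field_simps)
qed

section \<open>Comparison of spectral radii through a common matrix \<open>C\<close>\<close>

text \<open>In the application \<open>C\<close> is the pseudoinverse of \<open>A\<close>, and
  \<open>P\<close>, \<open>V\<close> come from a regular splitting. With \<open>w = V x\<close> and
  \<open>y = C w\<close> for a subeigenvector \<open>x\<close> of \<open>P V\<close>, one gets
  \<open>r x \<le> P w \<le> y\<close> and
  \<open>r y \<le> C V P w = P V C w \<le> H C w = H y\<close>.\<close>

lemma rho_comparison_lower:
  assumes P: "P \<in> carrier_mat n m" and V: "V \<in> carrier_mat m n"
    and C: "C \<in> carrier_mat n m" and H: "H \<in> carrier_mat n n" and n: "n > 0"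
    and nn: "nonneg_mat P" "nonneg_mat V" "nonneg_mat C" "nonneg_mat H"
    and comm: "P * V * C = C * V * P"
    and PC: "mat_le P C" and HC: "mat_le (P * V * C) (H * C)"
  shows "rho (P * V) \<le> rho H"
proof (cases "rho (P * V) = 0")
  case True
  thus ?thesis using rho_nonneg[OF H n] by simp
next
  \<comment> \<open>Only a positive \<open>?r\<close> lets \<open>?r x \<le> y\<close> transfer a
    positive entry from \<open>x\<close> to \<open>y\<close>.\<close>
  case False
  let ?r = "rho (P * V)"
  have PV: "P * V \<in> carrier_mat n n" using P V by simp
  have r: "?r > 0" using False rho_nonneg[OF PV n] by simp
  obtain x where x: "x \<in> carrier_vec n" "x \<noteq> 0\<^sub>v n" "0\<^sub>v n \<le> x" "?r \<cdot>\<^sub>v x \<le> (P * V) *\<^sub>v x"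
    by (rule rho_subeigenvector[OF PV n nonneg_mat_mult[OF P V nn(1,2)]])
  define w where "w = V *\<^sub>v x"
  define y where "y = C *\<^sub>v w"
  have w: "w \<in> carrier_vec m" "0\<^sub>v m \<le> w"
    using V x nonneg_mult_mat_vec[OF V nn(2)] by (auto simp: w_def)
  have y: "y \<in> carrier_vec n" "0\<^sub>v n \<le> y"
    using C w nonneg_mult_mat_vec[OF C nn(3)] by (auto simp: y_def)
  have "?r \<cdot>\<^sub>v x \<le> P *\<^sub>v w" using x P V by (simp add: w_def)
  also have "\<dots> \<le> y" unfolding y_def by (rule mat_le_mult_mat_vec[OF P C PC w])
  finally have xy: "?r \<cdot>\<^sub>v x \<le> y" .
  have y0: "y \<noteq> 0\<^sub>v n"
  proof
    assume "y = 0\<^sub>v n"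
    obtain i where i: "i < n" "x $ i > 0" by (rule nonneg_vec_pos_entry[OF x(1,3,2)])
    have "?r * x $ i \<le> 0" using xy \<open>y = 0\<^sub>v n\<close> i x by (auto simp: less_eq_vec_def)
    thus False using r i by (simp add: mult_le_0_iff)
  qed
  have "?r \<cdot>\<^sub>v y = (C * V) *\<^sub>v (?r \<cdot>\<^sub>v x)"
    using C V x by (simp add: y_def w_def mult_mat_vec[of _ n n])
  also have "\<dots> \<le> (C * V) *\<^sub>v ((P * V) *\<^sub>v x)"
    by (rule mult_mat_vec_mono[OF _ nonneg_mat_mult[OF C V nn(3,2)] _ x(4)]) (use C V P x in auto)
  also have "\<dots> = (C * V * P) *\<^sub>v w"
    using assoc_mult_mat_vec[of "C * V" n n P m w] assoc_mult_mat_vec[OF P V x(1)] C V P w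
    by (simp add: w_def del: assoc_mult_mat_vec)
  \<comment> \<open>Commutation brings \<open>C\<close> next to \<open>w\<close>, where the bound by
    \<open>H * C\<close> applies.\<close>
  also have "\<dots> = (P * V * C) *\<^sub>v w" by (simp only: comm)
  also have "\<dots> \<le> (H * C) *\<^sub>v w"
    by (rule mat_le_mult_mat_vec[OF _ _ HC w]) (use P V C H in auto)
  also have "\<dots> = H *\<^sub>v y" using H C w by (simp add: y_def)
  finally show ?thesis by (rule rho_ge_of_subinvariant[OF H nn(4) y(1) y0 y(2)])
qed

text \<open>The bound on \<open>H * C\<close> has \<open>H\<close> on the left, so a subeigenvector
  of \<open>H\<close> can meet it only from the left; hence the transposes. With
  \<open>u = ?C z\<close> and \<open>v = ?V u\<close> the chain is \<open>r u \<le> ?P v\<close>,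
  then \<open>r v \<le> ?V ?P v\<close>, and the last product is the transpose of
  \<open>P * V\<close> applied to \<open>v\<close>.\<close>

lemma rho_comparison_upper:
  assumes P: "P \<in> carrier_mat n m" and V: "V \<in> carrier_mat m n"
    and C: "C \<in> carrier_mat n m" and H: "H \<in> carrier_mat n n" and n: "n > 0"
    and nn: "nonneg_mat P" "nonneg_mat V" "nonneg_mat C" "nonneg_mat H"
    and comm: "P * V * C = C * V * P"
    and A: "A \<in> carrier_mat m n" and CA: "C * A = 1\<^sub>m n"
    and HC: "mat_le (H * C) (P * V * C)"
  shows "rho H \<le> rho (P * V)"
proof (cases "rho H = 0")
  case True
  thus ?thesis using rho_nonneg[of "P * V" n] P V n by simp
next
  case False
  let ?r = "rho H"
  let ?C = "transpose_mat C" and ?H = "transpose_mat H" and ?P = "transpose_mat P"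
    and ?V = "transpose_mat V"
  have r: "?r > 0" using False rho_nonneg[OF H n] by simp
  have Ht: "?H \<in> carrier_mat n n" and Ct: "?C \<in> carrier_mat m n"
    and Pt: "?P \<in> carrier_mat m n" and Vt: "?V \<in> carrier_mat n m"
    using H C P V by auto
  obtain z where z: "z \<in> carrier_vec n" "z \<noteq> 0\<^sub>v n" "0\<^sub>v n \<le> z" "?r \<cdot>\<^sub>v z \<le> ?H *\<^sub>v z"
    using rho_subeigenvector[OF Ht n nonneg_mat_transpose[OF nn(4)]] unfolding rho_transpose[OF H]
    by blast
  define u where "u = ?C *\<^sub>v z"
  define v where "v = ?V *\<^sub>v u"
  have u: "u \<in> carrier_vec m" "0\<^sub>v m \<le> u"
    using Ct z nonneg_mult_mat_vec[OF Ct nonneg_mat_transpose[OF nn(3)]] by (auto simp: u_def)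
  have v: "v \<in> carrier_vec n" "0\<^sub>v n \<le> v"
    using Vt u nonneg_mult_mat_vec[OF Vt nonneg_mat_transpose[OF nn(2)]] by (auto simp: v_def)
  \<comment> \<open>The left inverse property recovers \<open>z\<close> from \<open>u\<close>, since
    \<open>z\<close> is the transpose of \<open>A\<close> applied to \<open>u\<close>.\<close>
  have u0: "u \<noteq> 0\<^sub>v m"
  proof
    assume 0: "u = 0\<^sub>v m"
    have "z = transpose_mat (C * A) *\<^sub>v z" using z CA by simp
    also have "\<dots> = transpose_mat A *\<^sub>v u"
      using z A C by (simp add: u_def transpose_mult[OF C A])
    also have "\<dots> = 0\<^sub>v n" using 0 mult_mat_zero_vec[of "transpose_mat A" n m] A by simp
    finally show False using z by simp
  qed
  have "?r \<cdot>\<^sub>v u = ?C *\<^sub>v (?r \<cdot>\<^sub>v z)"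
    using Ct z by (simp add: u_def mult_mat_vec)
  also have "\<dots> \<le> ?C *\<^sub>v (?H *\<^sub>v z)"
    by (rule mult_mat_vec_mono[OF Ct nonneg_mat_transpose[OF nn(3)] _ z(4)]) (use Ht z in auto)
  also have "\<dots> = transpose_mat (H * C) *\<^sub>v z"
    using z H C by (simp add: transpose_mult[OF H C])
  also have "\<dots> \<le> transpose_mat (P * V * C) *\<^sub>v z"
    by (rule mat_le_mult_mat_vec[OF _ _ mat_le_transpose[OF HC] z(1,3)]) (use P V C H in auto)
  also have "\<dots> = transpose_mat (C * V * P) *\<^sub>v z" by (simp only: comm)
  also have "\<dots> = ?P *\<^sub>v v"
    using transpose_mult[of "C * V" n n P m] transpose_mult[OF C V]
      assoc_mult_mat_vec[OF Pt _ z(1), of "?V * ?C"] assoc_mult_mat_vec[OF Vt Ct z(1)] P V C Vt Ct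
    by (simp add: u_def v_def del: assoc_mult_mat assoc_mult_mat_vec)
  finally have uv: "?r \<cdot>\<^sub>v u \<le> ?P *\<^sub>v v" .
  \<comment> \<open>A zero \<open>v\<close> would force \<open>?r u \<le> 0\<close>, although
    \<open>u\<close> has a positive entry.\<close>
  have v0: "v \<noteq> 0\<^sub>v n"
  proof
    assume "v = 0\<^sub>v n"
    hence "?r \<cdot>\<^sub>v u \<le> 0\<^sub>v m" using uv mult_mat_zero_vec[OF Pt] by simp
    moreover obtain i where i: "i < m" "u $ i > 0" by (rule nonneg_vec_pos_entry[OF u u0])
    ultimately have "?r * u $ i \<le> 0" using u by (auto simp: less_eq_vec_def)
    thus False using r i by (simp add: mult_le_0_iff)
  qed
  have "?r \<cdot>\<^sub>v v = ?V *\<^sub>v (?r \<cdot>\<^sub>v u)" using Vt u by (simp add: v_def mult_mat_vec)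
  also have "\<dots> \<le> ?V *\<^sub>v (?P *\<^sub>v v)"
    by (rule mult_mat_vec_mono[OF Vt nonneg_mat_transpose[OF nn(2)] _ uv]) (use Pt v in auto)
  also have "\<dots> = transpose_mat (P * V) *\<^sub>v v"
    using v P V by (simp add: transpose_mult[OF P V])
  finally have "?r \<le> rho (transpose_mat (P * V))"
    by (intro rho_ge_of_subinvariant[OF _
          nonneg_mat_transpose[OF nonneg_mat_mult[OF P V nn(1,2)]] v(1) v0 v(2)])
      (use P V in auto)
  thus ?thesis using rho_transpose[of "P * V" n] P V by simp
qed

section \<open>Moore-Penrose inverses and full column rank\<close>

text \<open>The four Penrose equations as a predicate, so that existence and uniqueness can be
  settled before the definite description in \<open>pinv\<close> is evaluated.\<close>

definition is_pinv :: "real mat \<Rightarrow> real mat \<Rightarrow> bool" where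
  "is_pinv A X \<longleftrightarrow> X \<in> carrier_mat (dim_col A) (dim_row A) \<and>
     A * X * A = A \<and> X * A * X = X \<and>
     transpose_mat (A * X) = A * X \<and> transpose_mat (X * A) = X * A"

lemma is_pinv_carrier: "A \<in> carrier_mat m n \<Longrightarrow> is_pinv A X \<Longrightarrow> X \<in> carrier_mat n m"
  by (auto simp: is_pinv_def)

text \<open>An orthogonal projection is determined by its range. The two product equations say that
  each range contains the other, and transposing \<open>Q * P = P\<close> gives
  \<open>P * Q = P\<close>.\<close>

lemma symmetric_idempotents_eq:
  fixes P Q :: "'a :: comm_semiring_1 mat"
  assumes "P \<in> carrier_mat m m" "Q \<in> carrier_mat m m"
    and "transpose_mat P = P" "transpose_mat Q = Q" "P * Q = Q" "Q * P = P"
  shows "P = Q"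
proof -
  have "P = transpose_mat (Q * P)" using assms by simp
  also have "\<dots> = P * Q" using transpose_mult[OF assms(2,1)] assms(3,4) by simp
  finally show ?thesis using assms(5) by simp
qed

lemma is_pinv_unique:
  assumes A: "A \<in> carrier_mat m n" and X: "is_pinv A X" and Y: "is_pinv A Y"
  shows "X = Y"
proof -
  note c = is_pinv_carrier[OF A X] is_pinv_carrier[OF A Y]
  note X' = X[unfolded is_pinv_def] and Y' = Y[unfolded is_pinv_def]
  have AX: "A * X = A * Y"
  proof (rule symmetric_idempotents_eq)
    show "A * X * (A * Y) = A * Y"
      using assoc_mult_mat[of "A * X" m m A n Y m] A c X' by simp
    show "A * Y * (A * X) = A * X"
      using assoc_mult_mat[of "A * Y" m m A n X m] A c Y' by simp
  qed (use A c X' Y' in auto)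
  \<comment> \<open>Here the products absorb in the opposite order, as for projections with a common
    kernel; transposing brings them into the form with a common range.\<close>
  have XA: "transpose_mat (X * A) = transpose_mat (Y * A)"
  proof (rule symmetric_idempotents_eq)
    have "Y * A * (X * A) = Y * A" "X * A * (Y * A) = X * A"
      using assoc_mult_mat[of Y n m A n "X * A" n] assoc_mult_mat[of X n m A n "Y * A" n]
        assoc_mult_mat[of A m n X m A n] assoc_mult_mat[of A m n Y m A n] A c X' Y'
      by (simp_all del: assoc_mult_mat)
    moreover have XA: "X * A \<in> carrier_mat n n" and YA: "Y * A \<in> carrier_mat n n"
      using A c by auto
    ultimately show "transpose_mat (X * A) * transpose_mat (Y * A) = transpose_mat (Y * A)"
      "transpose_mat (Y * A) * transpose_mat (X * A) = transpose_mat (X * A)"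
      using transpose_mult[OF YA XA] transpose_mult[OF XA YA] by simp_all
  qed (use A c X' Y' in auto)
  have "X = X * (A * X)" using X' A c by simp
  also have "\<dots> = X * A * Y" using AX A c by simp
  also have "\<dots> = Y * A * Y" using XA X' Y' by simp
  also have "\<dots> = Y" using Y' by simp
  finally show ?thesis .
qed

lemma is_pinv_pinv:
  assumes A: "A \<in> carrier_mat m n" and X: "is_pinv A X"
  shows "is_pinv A (pinv A)"
proof -
  have "pinv A = (THE X. is_pinv A X)" unfolding pinv_def is_pinv_def ..
  also have "\<dots> = X" by (rule the_equality[of "is_pinv A", OF X]) (rule is_pinv_unique[OF A _ X])
  finally show ?thesis using X by simp
qed

lemma scalar_prod_self_eq_0:
  fixes v :: "real vec"
  assumes "v \<in> carrier_vec n" "v \<bullet> v = 0"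
  shows "v = 0\<^sub>v n"
  using assms by (intro eq_vecI) (auto simp: scalar_prod_def sum_nonneg_eq_0_iff)

lemma inverse_of_trivial_kernel:
  fixes G :: "'a :: field mat"
  assumes G: "G \<in> carrier_mat n n" and ker: "mat_kernel G \<subseteq> {0\<^sub>v n}"
  obtains K where "K \<in> carrier_mat n n" "K * G = 1\<^sub>m n" "G * K = 1\<^sub>m n"
proof -
  have "det G \<noteq> 0" using det_0_iff_vec_prod_zero[OF G] mat_kernelI[OF G] ker by blast
  from det_non_zero_imp_unit[OF G this] show ?thesis
    using that unfolding Units_def by (auto simp: ring_mat_simps)
qed

text \<open>The Gram matrix of \<open>A\<close> is invertible, because \<open>x\<close> in its
  kernel gives \<open>A x\<close> of norm zero. With \<open>K\<close> its inverse, \<open>K\<close>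
  times the transpose of \<open>A\<close> satisfies the Penrose equations.\<close>

lemma pinv_full_column_rank:
  assumes A: "A \<in> carrier_mat m n" and ker: "mat_kernel A \<subseteq> {0\<^sub>v n}"
  shows "is_pinv A (pinv A)" "pinv A * A = 1\<^sub>m n"
proof -
  let ?T = "transpose_mat A"
  have T: "?T \<in> carrier_mat n m" using A by simp
  have G: "?T * A \<in> carrier_mat n n" using A by simp
  obtain K where K: "K \<in> carrier_mat n n" "K * (?T * A) = 1\<^sub>m n" "?T * A * K = 1\<^sub>m n"
  proof (rule inverse_of_trivial_kernel[OF G], rule subsetI)
    fix x assume "x \<in> mat_kernel (?T * A)"
    hence x: "x \<in> carrier_vec n" and 0: "?T * A *\<^sub>v x = 0\<^sub>v n" using mat_kernelD[OF G] by auto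
    have Ax: "A *\<^sub>v x \<in> carrier_vec m" using A x by simp
    have "(A *\<^sub>v x) \<bullet> (A *\<^sub>v x) = (?T *\<^sub>v (A *\<^sub>v x)) \<bullet> x"
      using transpose_vec_mult_scalar[OF A x Ax] by simp
    also have "\<dots> = 0" using 0 assoc_mult_mat_vec[OF T A x] x by simp
    finally have "A *\<^sub>v x = 0\<^sub>v m" by (rule scalar_prod_self_eq_0[OF Ax])
    thus "x \<in> {0\<^sub>v n}" using ker mat_kernelI[OF A x] by blast
  qed
  have GT: "transpose_mat (?T * A) = ?T * A" using transpose_mult[OF T A] by simp
  have KTc: "transpose_mat K \<in> carrier_mat n n" using K by simp
  \<comment> \<open>The inverse of a symmetric matrix is symmetric; this is what makes
    \<open>A * K * ?T\<close> symmetric.\<close>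
  have "transpose_mat K = transpose_mat K * (?T * A * K)"
    unfolding K(3) using KTc by simp
  also have "\<dots> = transpose_mat K * transpose_mat (?T * A) * K"
    unfolding GT by (rule assoc_mult_mat[OF KTc G K(1), symmetric])
  also have "\<dots> = transpose_mat (?T * A * K) * K"
    unfolding transpose_mult[OF G K(1)] ..
  also have "\<dots> = K" unfolding K(3) using K(1) by simp
  finally have KT: "transpose_mat K = K" .
  define X where "X = K * ?T"
  have X: "X \<in> carrier_mat n m" using K T by (simp add: X_def)
  have XA: "X * A = 1\<^sub>m n" using K T A by (simp add: X_def)
  have "A * X * A = A" using X A XA by simp
  moreover have "X * A * X = X" using X XA by simp
  moreover have "transpose_mat (A * X) = A * X"
    using transpose_mult[OF A X] transpose_mult[OF K(1) T] assoc_mult_mat[OF A K(1) T] KT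
    by (simp add: X_def del: assoc_mult_mat)
  ultimately have iX: "is_pinv A X" unfolding is_pinv_def using X A XA by simp
  show i: "is_pinv A (pinv A)" by (rule is_pinv_pinv[OF A iX])
  show "pinv A * A = 1\<^sub>m n" using is_pinv_unique[OF A i iX] XA by simp
qed

text \<open>A kernel vector \<open>x\<close> of \<open>A\<close> is orthogonal to the range of the
  transpose, hence to every \<open>E k x\<close>. These vectors sum to \<open>x\<close>, so
  \<open>x\<close> is orthogonal to itself.\<close>

lemma trivial_kernel_of_multisplitting:
  fixes A :: "real mat"
  assumes A: "A \<in> carrier_mat m n"
    and E: "\<And>k. k < p \<Longrightarrow> E k \<in> carrier_mat n n"
    and sumE: "\<And>i j. i < n \<Longrightarrow> j < n \<Longrightarrow> (\<Sum>k<p. E k $$ (i,j)) = 1\<^sub>m n $$ (i,j)"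
    and rangeE: "\<And>k. k < p \<Longrightarrow> mat_range (E k) \<subseteq> mat_range (transpose_mat A)"
  shows "mat_kernel A \<subseteq> {0\<^sub>v n}"
proof
  fix x assume "x \<in> mat_kernel A"
  hence x: "x \<in> carrier_vec n" and Ax: "A *\<^sub>v x = 0\<^sub>v m" using mat_kernelD[OF A] by auto
  have orth: "x \<bullet> (E k *\<^sub>v x) = 0" if k: "k < p" for k
  proof -
    have "E k *\<^sub>v x \<in> mat_range (E k)" using E[OF k] x unfolding mat_range_def by auto
    then obtain y where y: "y \<in> carrier_vec m" "E k *\<^sub>v x = transpose_mat A *\<^sub>v y"
      using rangeE[OF k] A unfolding mat_range_def by auto
    have "x \<bullet> (E k *\<^sub>v x) = (transpose_mat A *\<^sub>v y) \<bullet> x"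
      using y x A by (metis comm_scalar_prod mult_mat_vec_carrier transpose_carrier_mat)
    also have "\<dots> = 0" using transpose_vec_mult_scalar[OF A x y(1)] Ax y by simp
    finally show ?thesis .
  qed
  have "x \<bullet> x = (\<Sum>i<n. x $ i * (\<Sum>j<n. 1\<^sub>m n $$ (i,j) * x $ j))"
    using x by (auto simp: scalar_prod_def lessThan_atLeast0 one_mat_def
        if_distrib[of "\<lambda>c. c * _"] cong: if_cong intro!: sum.cong)
  also have "\<dots> = (\<Sum>i<n. x $ i * (\<Sum>j<n. (\<Sum>k<p. E k $$ (i,j)) * x $ j))"
    using sumE by simp
  also have "\<dots> = (\<Sum>i<n. \<Sum>j<n. \<Sum>k<p. x $ i * (E k $$ (i,j) * x $ j))"
    by (simp add: sum_distrib_left sum_distrib_right)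
  also have "\<dots> = (\<Sum>i<n. \<Sum>k<p. \<Sum>j<n. x $ i * (E k $$ (i,j) * x $ j))"
    by (intro sum.cong sum.swap refl)
  also have "\<dots> = (\<Sum>k<p. \<Sum>i<n. \<Sum>j<n. x $ i * (E k $$ (i,j) * x $ j))"
    by (rule sum.swap)
  also have "\<dots> = (\<Sum>k<p. x \<bullet> (E k *\<^sub>v x))"
  proof (rule sum.cong[OF refl])
    fix k assume "k \<in> {..<p}"
    hence "E k \<in> carrier_mat n n" using E by simp
    thus "(\<Sum>i<n. \<Sum>j<n. x $ i * (E k $$ (i,j) * x $ j)) = x \<bullet> (E k *\<^sub>v x)"
      using x by (simp add: scalar_prod_def lessThan_atLeast0 sum_distrib_left)
  qed
  also have "\<dots> = 0" using orth by simp
  finally show "x \<in> {0\<^sub>v n}" using scalar_prod_self_eq_0[OF x] by simp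
qed

text \<open>Each column of \<open>A\<close> has the form \<open>U y\<close>, and
  \<open>U X U = U\<close> fixes such vectors.\<close>

lemma is_pinv_projects_range:
  assumes U: "U \<in> carrier_mat m n" and X: "is_pinv U X" and A: "A \<in> carrier_mat m k"
    and sub: "mat_range A \<subseteq> mat_range U"
  shows "U * X * A = A"
proof (rule mat_col_eqI)
  note Xc = is_pinv_carrier[OF U X]
  fix j assume "j < dim_col A"
  hence j: "j < k" using A by simp
  have "col A j = A *\<^sub>v unit_vec k j" using A j by (intro eq_vecI) auto
  moreover have "A *\<^sub>v unit_vec k j \<in> mat_range A" using A unfolding mat_range_def by auto
  ultimately have "col A j \<in> mat_range U" using sub by auto
  then obtain y where y: "y \<in> carrier_vec n" "col A j = U *\<^sub>v y"
    using U unfolding mat_range_def by auto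
  have "col (U * X * A) j = (U * X) *\<^sub>v (U *\<^sub>v y)"
    using col_mult2[of "U * X" m m A k j] U Xc A j y by simp
  also have "\<dots> = (U * X * U) *\<^sub>v y" using assoc_mult_mat_vec[of "U * X" m m U n y] U Xc y
    by (simp del: assoc_mult_mat assoc_mult_mat_vec)
  also have "\<dots> = col A j" using X y unfolding is_pinv_def by simp
  finally show "col (U * X * A) j = col A j" .
qed (use U A in auto)

section \<open>Proper splittings of a matrix of full column rank\<close>

context
  fixes A U V :: "real mat" and m n :: nat
  assumes A: "A \<in> carrier_mat m n"
    and ker: "mat_kernel A \<subseteq> {0\<^sub>v n}"
    and split: "proper_splitting A U V"
begin

lemma proper_splitting_carrier: "U \<in> carrier_mat m n" "V \<in> carrier_mat m n"
  using split A by (auto simp: proper_splitting_def)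

lemma proper_splitting_pinv: "is_pinv U (pinv U)" "pinv U * U = 1\<^sub>m n"
proof -
  have "mat_kernel U \<subseteq> {0\<^sub>v n}" using split ker by (simp add: proper_splitting_def)
  thus "is_pinv U (pinv U)" "pinv U * U = 1\<^sub>m n"
    using pinv_full_column_rank[OF proper_splitting_carrier(1)] by blast+
qed

lemma proper_splitting_pinv_carrier: "pinv U \<in> carrier_mat n m"
  by (rule is_pinv_carrier[OF proper_splitting_carrier(1) proper_splitting_pinv(1)])

text \<open>Both sides are the orthogonal projection onto the common range of \<open>U\<close> and
  \<open>A\<close>.\<close>

lemma proper_splitting_projection: "U * pinv U = A * pinv A"
proof (rule symmetric_idempotents_eq)
  note iA = pinv_full_column_rank(1)[OF A ker]
  note c = A proper_splitting_carrier(1) is_pinv_carrier[OF A iA] proper_splitting_pinv_carrier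
  have r: "mat_range A = mat_range U" using split by (simp add: proper_splitting_def)
  show "U * pinv U \<in> carrier_mat m m" "A * pinv A \<in> carrier_mat m m" using c by auto
  show "transpose_mat (U * pinv U) = U * pinv U" "transpose_mat (A * pinv A) = A * pinv A"
    using proper_splitting_pinv(1) iA unfolding is_pinv_def by blast+
  have 1: "U * pinv U * A = A"
    using is_pinv_projects_range[OF c(2) proper_splitting_pinv(1) A] r by simp
  have "U * pinv U * (A * pinv A) = U * pinv U * A * pinv A"
    using c by (intro assoc_mult_mat[symmetric]) auto
  thus "U * pinv U * (A * pinv A) = A * pinv A" using 1 by simp
  have 2: "A * pinv A * U = U"
    using is_pinv_projects_range[OF A iA c(2)] r by simp
  have "A * pinv A * (U * pinv U) = A * pinv A * U * pinv U"
    using c by (intro assoc_mult_mat[symmetric]) auto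
  thus "A * pinv A * (U * pinv U) = U * pinv U" using 2 by simp
qed

text \<open>Insert \<open>V = U - A\<close>. Both pseudoinverses are left inverses, which settles
  one term of each difference; the common projection \<open>U * pinv U = A * pinv A\<close> is
  absorbed by either pseudoinverse and settles the other.\<close>

lemma proper_splitting_pinv_diff:
  "pinv U * V * pinv A = pinv A - pinv U" "pinv A * V * pinv U = pinv A - pinv U"
proof -
  note iA = pinv_full_column_rank[OF A ker]
  have C: "pinv A \<in> carrier_mat n m" by (rule is_pinv_carrier[OF A iA(1)])
  note c = A proper_splitting_carrier C proper_splitting_pinv_carrier
  have "A = U - V" using split by (simp add: proper_splitting_def)
  hence V: "V = U - A" using c by (auto intro!: eq_matI)
  have PAC: "pinv U * (A * pinv A) = pinv U"
    using proper_splitting_pinv(1) c unfolding proper_splitting_projection[symmetric] is_pinv_def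
    by simp
  have CUP: "pinv A * (U * pinv U) = pinv A"
    using iA(1) c unfolding proper_splitting_projection is_pinv_def by simp
  have "pinv U * V * pinv A = pinv U * U * pinv A - pinv U * A * pinv A"
    unfolding V using c
    by (simp add: mult_minus_distrib_mat[of _ n m] minus_mult_distrib_mat[of _ n n])
  also have "\<dots> = pinv A - pinv U"
    using c PAC proper_splitting_pinv(2) by simp
  finally show "pinv U * V * pinv A = pinv A - pinv U" .
  have "pinv A * V * pinv U = pinv A * U * pinv U - pinv A * A * pinv U"
    unfolding V using c
    by (simp add: mult_minus_distrib_mat[of _ n m] minus_mult_distrib_mat[of _ n n])
  also have "\<dots> = pinv A - pinv U"
    using c CUP iA(2) by simp
  finally show "pinv A * V * pinv U = pinv A - pinv U" .
qed

end

section \<open>Entrywise inequalities and sums weighted by \<open>E k\<close>\<close>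

lemma mat_leD:
  assumes "mat_le M N" "M \<in> carrier_mat n k" "i < n" "j < k"
  shows "M $$ (i,j) \<le> N $$ (i,j)"
  using assms by (auto simp: mat_le_def)

lemma nonneg_mat_diff:
  assumes "M \<in> carrier_mat n k" "N \<in> carrier_mat n k" "nonneg_mat (M - N)"
  shows "mat_le N M"
  using assms by (auto simp: nonneg_mat_def mat_le_def)

lemma mat_le_mult_left:
  assumes "M \<in> carrier_mat n k" "nonneg_mat M" "D \<in> carrier_mat k l" "mat_le D D'"
  shows "mat_le (M * D) (M * D')"
  using assms by (auto simp: nonneg_mat_def mat_le_def scalar_prod_def intro!: sum_mono mult_left_mono)

lemma mat_le_minus_left:
  assumes "C \<in> carrier_mat n k" "M \<in> carrier_mat n k" "mat_le M N"
  shows "mat_le (C - N) (C - M)"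
  using assms by (auto simp: mat_le_def)

text \<open>The weights form a partition of unity; this lets a fixed matrix be compared summand by
  summand with a weighted sum of varying ones.\<close>

lemma sum_weights_mult:
  assumes E: "\<And>k. k < p \<Longrightarrow> E k \<in> carrier_mat n n"
    and sumE: "\<And>i j. i < n \<Longrightarrow> j < n \<Longrightarrow> (\<Sum>k<p. E k $$ (i,j)) = (1\<^sub>m n :: real mat) $$ (i,j)"
    and D: "D \<in> carrier_mat n m" and i: "i < n" and j: "j < m"
  shows "(\<Sum>k<p. (E k * D) $$ (i,j)) = D $$ (i,j)"
proof -
  have "(\<Sum>k<p. (E k * D) $$ (i,j)) = (\<Sum>k<p. \<Sum>l<n. E k $$ (i,l) * D $$ (l,j))"
  proof (rule sum.cong[OF refl])
    fix k assume "k \<in> {..<p}"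
    hence "E k \<in> carrier_mat n n" using E by simp
    thus "(E k * D) $$ (i,j) = (\<Sum>l<n. E k $$ (i,l) * D $$ (l,j))"
      using D i j by (simp add: scalar_prod_def lessThan_atLeast0)
  qed
  also have "\<dots> = (\<Sum>l<n. \<Sum>k<p. E k $$ (i,l) * D $$ (l,j))" by (rule sum.swap)
  also have "\<dots> = (\<Sum>l<n. 1\<^sub>m n $$ (i,l) * D $$ (l,j))"
    using sumE i by (simp flip: sum_distrib_right)
  also have "\<dots> = D $$ (i,j)"
    using i by (simp add: if_distrib[of "\<lambda>c. c * _"] cong: if_cong)
  finally show ?thesis .
qed

lemma multisplit_H_carrier: "multisplit_H n p U V E \<in> carrier_mat n n"
  by (simp add: multisplit_H_def)

lemma multisplit_H_mult:
  assumes c: "\<And>k. k < p \<Longrightarrow> E k * pinv (U k) * V k \<in> carrier_mat n n"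
    and C: "C \<in> carrier_mat n m" and i: "i < n" and j: "j < m"
  shows "(multisplit_H n p U V E * C) $$ (i,j) = (\<Sum>k<p. (E k * pinv (U k) * V k * C) $$ (i,j))"
proof -
  let ?M = "\<lambda>k. E k * pinv (U k) * V k"
  have "(multisplit_H n p U V E * C) $$ (i,j) = (\<Sum>l<n. (\<Sum>k<p. ?M k $$ (i,l)) * C $$ (l,j))"
    using C i j by (simp add: multisplit_H_def scalar_prod_def lessThan_atLeast0)
  also have "\<dots> = (\<Sum>l<n. \<Sum>k<p. ?M k $$ (i,l) * C $$ (l,j))"
    by (simp add: sum_distrib_right)
  also have "\<dots> = (\<Sum>k<p. \<Sum>l<n. ?M k $$ (i,l) * C $$ (l,j))" by (rule sum.swap)
  also have "\<dots> = (\<Sum>k<p. (?M k * C) $$ (i,j))"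
  proof (rule sum.cong[OF refl])
    fix k assume "k \<in> {..<p}"
    hence "?M k \<in> carrier_mat n n" using c by simp
    from carrier_matD[OF this] show "(\<Sum>l<n. ?M k $$ (i,l) * C $$ (l,j)) = (?M k * C) $$ (i,j)"
      using C i j
      by (subst index_mult_mat) (simp_all add: scalar_prod_def lessThan_atLeast0 del: index_mult_mat(1))
  qed
  finally show ?thesis .
qed

section \<open>Comparison of \<open>H\<close> with the two regular splittings\<close>

theorem theorem5p9:
  fixes A Uo Vo Ul Vl :: "real mat" and U V E :: "nat \<Rightarrow> real mat" and m n p :: nat
  assumes A: "A \<in> carrier_mat m n"
    and semimonotone: "nonneg_mat (pinv A)"
    and multi: "proper_weak_regular_multisplitting A p U V E"
    and rangeE: "\<And>k. k < p \<Longrightarrow> mat_range (E k) \<subseteq> mat_range (transpose_mat A)"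
    and Uo: "Uo \<in> carrier_mat m n" and Ul: "Ul \<in> carrier_mat m n"
    and bounds: "\<And>k. k < p \<Longrightarrow> mat_le (pinv Uo) (pinv (U k)) \<and> mat_le (pinv (U k)) (pinv Ul)"
  shows "(proper_regular_splitting A Uo Vo \<and>
            (\<forall>i < n. (\<Sum>j<m. pinv Uo $$ (i,j)) > 0)
            \<longrightarrow> rho (multisplit_H n p U V E) \<le> rho (pinv Uo * Vo))
       \<and> (proper_regular_splitting A Ul Vl
            \<longrightarrow> rho (pinv Ul * Vl) \<le> rho (multisplit_H n p U V E))"
proof -
  let ?H = "multisplit_H n p U V E" and ?C = "pinv A"
  have E: "E k \<in> carrier_mat n n" and E0: "nonneg_mat (E k)" if "k < p" for k
    using multi that A by (auto simp: proper_weak_regular_multisplitting_def)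
  have sumE: "(\<Sum>k<p. E k $$ (i,j)) = 1\<^sub>m n $$ (i,j)" if "i < n" "j < n" for i j
    using multi that A by (auto simp: proper_weak_regular_multisplitting_def)
  have ker: "mat_kernel A \<subseteq> {0\<^sub>v n}"
    by (rule trivial_kernel_of_multisplitting[OF A E sumE rangeE])
  note iA = pinv_full_column_rank[OF A ker]
  have C: "?C \<in> carrier_mat n m" by (rule is_pinv_carrier[OF A iA(1)])
  have split: "proper_splitting A (U k) (V k)" and UV0: "nonneg_mat (pinv (U k) * V k)" if "k < p" for k
    using multi that
    by (auto simp: proper_weak_regular_multisplitting_def proper_weak_regular_splitting_def)
  note carr = proper_splitting_carrier[OF A ker split] proper_splitting_pinv_carrier[OF A ker split] E
  have H: "?H \<in> carrier_mat n n" by (rule multisplit_H_carrier)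
  have EPV: "E k * pinv (U k) * V k \<in> carrier_mat n n" if "k < p" for k
    by (rule mult_carrier_mat[OF mult_carrier_mat[OF E carr(3)] carr(2)]) (rule that)+
  \<comment> \<open>The bracketing matters: weak regularity gives the sign of
    \<open>pinv (U k) * V k\<close>, not of \<open>V k\<close> itself.\<close>
  have EPV0: "nonneg_mat (E k * pinv (U k) * V k)" if k: "k < p" for k
    unfolding assoc_mult_mat[OF E[OF k] carr(3)[OF k] carr(2)[OF k]]
    by (rule nonneg_mat_mult[OF E[OF k] _ E0[OF k] UV0[OF k]])
      (rule mult_carrier_mat[OF carr(3)[OF k] carr(2)[OF k]])
  have "0 \<le> (E k * pinv (U k) * V k) $$ (i,j)" if "k < p" "i < n" "j < n" for k i j
    using EPV0[OF that(1)] carrier_matD[OF EPV[OF that(1)]] that(2,3)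
    unfolding nonneg_mat_def by (simp del: assoc_mult_mat index_mult_mat)
  hence H0: "nonneg_mat ?H"
    unfolding nonneg_mat_def multisplit_H_def by (auto intro!: sum_nonneg)
  \<comment> \<open>Multiplication by \<open>?C\<close> eliminates every \<open>V k\<close> and
    leaves only pseudoinverses, to which the assumed bounds apply.\<close>
  have HC: "(?H * ?C) $$ (i,j) = (\<Sum>k<p. (E k * (?C - pinv (U k))) $$ (i,j))"
    if "i < n" "j < m" for i j
  proof -
    have "(?H * ?C) $$ (i,j) = (\<Sum>k<p. (E k * pinv (U k) * V k * ?C) $$ (i,j))"
      by (rule multisplit_H_mult[OF EPV C that])
    also have "\<dots> = (\<Sum>k<p. (E k * (?C - pinv (U k))) $$ (i,j))"
    proof (rule sum.cong[OF refl])
      fix k assume "k \<in> {..<p}"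
      hence k: "k < p" by simp
      have "E k * pinv (U k) * V k * ?C = E k * (pinv (U k) * V k * ?C)"
        using assoc_mult_mat[OF E carr(3) carr(2), OF k k k]
          assoc_mult_mat[OF E[OF k] mult_carrier_mat[OF carr(3,2)[OF k]] C] by simp
      thus "(E k * pinv (U k) * V k * ?C) $$ (i,j) = (E k * (?C - pinv (U k))) $$ (i,j)"
        using proper_splitting_pinv_diff(1)[OF A ker split[OF k]] by simp
    qed
    finally show ?thesis .
  qed
  have "rho ?H \<le> rho (pinv Uo * Vo)"
    if reg: "proper_regular_splitting A Uo Vo" and n: "n > 0"
  proof -
    have sp: "proper_splitting A Uo Vo" and Po: "nonneg_mat (pinv Uo)" and Vo: "nonneg_mat Vo"
      using reg by (auto simp: proper_regular_splitting_def)
    note c = proper_splitting_carrier[OF A ker sp] proper_splitting_pinv_carrier[OF A ker sp]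
    note d = proper_splitting_pinv_diff[OF A ker sp]
    have D: "?C - pinv Uo \<in> carrier_mat n m" by (rule minus_carrier_mat[OF c(3)])
    \<comment> \<open>The lower bound \<open>pinv Uo\<close> enlarges each difference
      \<open>?C - pinv (U k)\<close>. The resulting bound equals \<open>pinv Uo * Vo * ?C\<close>,
      as the upper comparison requires.\<close>
    have "mat_le (?H * ?C) (?C - pinv Uo)"
      unfolding mat_le_def
    proof (intro conjI allI impI)
      fix i j assume "i < dim_row (?H * ?C)" "j < dim_col (?H * ?C)"
      hence i: "i < n" and j: "j < m" using H C by auto
      have "(?H * ?C) $$ (i,j) \<le> (\<Sum>k<p. (E k * (?C - pinv Uo)) $$ (i,j))"
        unfolding HC[OF i j]
      proof (rule sum_mono)
        fix k assume "k \<in> {..<p}"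
        hence k: "k < p" by simp
        have "mat_le (E k * (?C - pinv (U k))) (E k * (?C - pinv Uo))"
          using mat_le_mult_left[OF E[OF k] E0[OF k] minus_carrier_mat[OF carr(3)[OF k]]
              mat_le_minus_left[OF C c(3)]] bounds[OF k] by blast
        thus "(E k * (?C - pinv (U k))) $$ (i,j) \<le> (E k * (?C - pinv Uo)) $$ (i,j)"
          by (rule mat_leD[OF _ mult_carrier_mat[OF E[OF k] minus_carrier_mat[OF carr(3)[OF k]]] i j])
      qed
      also have "\<dots> = (?C - pinv Uo) $$ (i,j)" by (rule sum_weights_mult[OF E sumE D i j])
      finally show "(?H * ?C) $$ (i,j) \<le> (?C - pinv Uo) $$ (i,j)" .
    qed (use H C c in auto)
    thus ?thesis
      by (intro rho_comparison_upper[OF c(3,2) C H n Po Vo semimonotone H0 _ A iA(2)])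
        (simp_all add: d)
  qed
  moreover have "rho (pinv Ul * Vl) \<le> rho ?H"
    if reg: "proper_regular_splitting A Ul Vl" and n: "n > 0"
  proof -
    have sp: "proper_splitting A Ul Vl" and Pl: "nonneg_mat (pinv Ul)" and Vl: "nonneg_mat Vl"
      using reg by (auto simp: proper_regular_splitting_def)
    note c = proper_splitting_carrier[OF A ker sp] proper_splitting_pinv_carrier[OF A ker sp]
    note d = proper_splitting_pinv_diff[OF A ker sp]
    have D: "?C - pinv Ul \<in> carrier_mat n m" by (rule minus_carrier_mat[OF c(3)])
    have "mat_le (?C - pinv Ul) (?H * ?C)"
      unfolding mat_le_def
    proof (intro conjI allI impI)
      fix i j assume "i < dim_row (?C - pinv Ul)" "j < dim_col (?C - pinv Ul)"
      hence i: "i < n" and j: "j < m" using C c by auto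
      have "(?C - pinv Ul) $$ (i,j) = (\<Sum>k<p. (E k * (?C - pinv Ul)) $$ (i,j))"
        by (rule sum_weights_mult[OF E sumE D i j, symmetric])
      also have "\<dots> \<le> (?H * ?C) $$ (i,j)"
        unfolding HC[OF i j]
      proof (rule sum_mono)
        fix k assume "k \<in> {..<p}"
        hence k: "k < p" by simp
        have "mat_le (E k * (?C - pinv Ul)) (E k * (?C - pinv (U k)))"
          using mat_le_mult_left[OF E[OF k] E0[OF k] D mat_le_minus_left[OF C carr(3)[OF k]]]
            bounds[OF k] by blast
        thus "(E k * (?C - pinv Ul)) $$ (i,j) \<le> (E k * (?C - pinv (U k))) $$ (i,j)"
          by (rule mat_leD[OF _ mult_carrier_mat[OF E[OF k] D] i j])
      qed
      finally show "(?C - pinv Ul) $$ (i,j) \<le> (?H * ?C) $$ (i,j)" .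
    qed (use H C c in auto)
    \<comment> \<open>The difference \<open>?C - pinv Ul\<close> is the product
      \<open>?C * Vl * pinv Ul\<close> of nonnegative matrices.\<close>
    moreover have "mat_le (pinv Ul) ?C"
    proof (rule nonneg_mat_diff[OF C c(3)])
      show "nonneg_mat (?C - pinv Ul)"
        unfolding d(2)[symmetric]
        by (rule nonneg_mat_mult[OF mult_carrier_mat[OF C c(2)] c(3)
              nonneg_mat_mult[OF C c(2) semimonotone Vl] Pl])
    qed
    ultimately show ?thesis
      by (intro rho_comparison_lower[OF c(3,2) C H n Pl Vl semimonotone H0]) (simp_all add: d)
  qed
  \<comment> \<open>In dimension 0 no eigenvector exists, but both arguments are the same empty
    matrix, so the values of \<open>rho\<close> agree whatever they are.\<close>
  moreover have "rho (pinv W * X) = rho ?H" if "proper_regular_splitting A W X" "n = 0" for W X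
  proof -
    have "pinv W * X \<in> carrier_mat n n"
      using that(1) proper_splitting_carrier[OF A ker, of W X]
        proper_splitting_pinv_carrier[OF A ker, of W X]
      by (auto simp: proper_regular_splitting_def)
    hence "pinv W * X = ?H" using that(2) H by (intro eq_matI) auto
    thus ?thesis by simp
  qed
  ultimately show ?thesis by (metis gr0I order_refl)
qed

end
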